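(* Let $\mathcal X$ be a finite set. Consider the classical i.i.d. state discrimination problem with composite null hypothesis given by a non-empty set $R\subseteq\mathcal S(\mathcal X)$ of probability density functions on $\mathcal X$ and simple alternative hypothesis $\sigma\in\mathcal S(\mathcal X)$. Assume that $$\sup_{\rho\in R}\Big(-\log\min_{x\in\operatorname{supp}\rho}\rho(x)\Big)<+\infty.$$ Then for any $r$ with $D(R\|\sigma)<r<\inf_{\rho\in R}r_\infty(\rho\|\sigma)$, $$\mathrm{sc}_r(R\|\sigma)=H_r^*(R\|\sigma)=\sup_{\rho\in R}\mathrm{sc}_r(\rho\|\sigma).$$
   Context: $\log$ is natural, $-\log0=+\infty$. $D(\rho\|\sigma)=\sum_x\rho(x)\log\frac{\rho(x)}{\sigma(x)}$ if $\operatorname{supp}\rho\subseteq\operatorname{supp}\sigma$, else $+\infty$; $D(R\|\sigma)=\inf_{\rho\in R}D(\rho\|\sigma)$. For $\alpha>1$, $D_\alpha(\rho\|\sigma)=\frac1{\alpha-1}\log\sum_x\rho(x)^\alpha\sigma(x)^{1-\alpha}$ (sum over $\operatorname{supp}\rho$) if $\operatorname{supp}\rho\subseteq\operatorname{supp}\sigma$, else $+\infty$. Hoeffding anti-divergence: $H_r^*(\rho\|\sigma)=\max\big\{0,\sup_{\alpha>1}\frac{\alpha-1}\alpha[r-D_\alpha(\rho\|\sigma)]\big\}$, $H_r^*(R\|\sigma)=\sup_{\rho\in R}H_r^*(\rho\|\sigma)$. If $\operatorname{supp}\rho\subseteq\operatorname{supp}\sigma$, $r_\infty(\rho\|\sigma)=-\log\sigma(\mathcal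 X_\infty)$, where $\mathcal X_\infty$ is the set of $x\in\operatorname{supp}\sigma$ at which $\rho(x)/\sigma(x)$ attains its maximum over $\operatorname{supp}\sigma$; otherwise $r_\infty(\rho\|\sigma)=+\infty$. A test is $T_n:\mathcal X^n\to[0,1]$, $\omega(T_n)=\sum_{\underline x}\omega(\underline x)T_n(\underline x)$. The strong converse exponent is $$\mathrm{sc}_r(R\|\sigma)=\inf\Big\{\limsup_{n}-\tfrac1n\log\inf_{\rho\in R}\rho^{\otimes n}(T_n):\ \liminf_n-\tfrac1n\log\sigma^{\otimes n}(T_n)\ge r\Big\},$$ the infimum being over all test sequences satisfying the condition; $\mathrm{sc}_r(\rho\|\sigma)=\mathrm{sc}_r(\{\rho\}\|\sigma)$. *)

theory Defs
  imports "HOL-Probability.Probability"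
begin

text \<open>
  Probability density functions on the finite set \<open>\<X>\<close> are rendered as \<open>'a pmf\<close> with
  \<open>'a :: finite\<close>; the support of \<open>\<rho>\<close> is \<open>set_pmf \<rho>\<close>. Elements of \<open>\<X>\<^sup>n\<close> are lists of
  length \<open>n\<close>, and the i.i.d. density \<open>\<rho>\<close> tensored \<open>n\<close> times is \<open>replicate_pmf n \<rho>\<close>.
\<close>

definition neg_log :: "real \<Rightarrow> ereal" where
  "neg_log x = (if x = 0 then \<infinity> else ereal (- ln x))"

text \<open>In the sum, terms with \<open>\<rho>(x) = 0\<close> vanish, which is the convention \<open>0 log 0 = 0\<close>.\<close>

definition rel_entropy :: "'a::finite pmf \<Rightarrow> 'a pmf \<Rightarrow> ereal" where
  "rel_entropy \<rho> \<sigma> =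
     (if set_pmf \<rho> \<subseteq> set_pmf \<sigma>
      then ereal (\<Sum>x\<in>UNIV. pmf \<rho> x * ln (pmf \<rho> x / pmf \<sigma> x)) else \<infinity>)"

definition rel_entropy_set :: "'a::finite pmf set \<Rightarrow> 'a pmf \<Rightarrow> ereal" where
  "rel_entropy_set R \<sigma> = (INF \<rho>\<in>R. rel_entropy \<rho> \<sigma>)"

definition renyi_div :: "real \<Rightarrow> 'a::finite pmf \<Rightarrow> 'a pmf \<Rightarrow> ereal" where
  "renyi_div \<alpha> \<rho> \<sigma> =
     (if set_pmf \<rho> \<subseteq> set_pmf \<sigma>
      then ereal (1 / (\<alpha> - 1) *
             ln (\<Sum>x\<in>set_pmf \<rho>. pmf \<rho> x powr \<alpha> * pmf \<sigma> x powr (1 - \<alpha>)))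
      else \<infinity>)"

definition hoeffding_anti_div :: "real \<Rightarrow> 'a::finite pmf \<Rightarrow> 'a pmf \<Rightarrow> ereal" where
  "hoeffding_anti_div r \<rho> \<sigma> =
     max 0 (SUP \<alpha>\<in>{1<..}. ereal ((\<alpha> - 1) / \<alpha>) * (ereal r - renyi_div \<alpha> \<rho> \<sigma>))"

definition hoeffding_anti_div_set :: "real \<Rightarrow> 'a::finite pmf set \<Rightarrow> 'a pmf \<Rightarrow> ereal" where
  "hoeffding_anti_div_set r R \<sigma> = (SUP \<rho>\<in>R. hoeffding_anti_div r \<rho> \<sigma>)"

definition max_ratio_set :: "'a::finite pmf \<Rightarrow> 'a pmf \<Rightarrow> 'a set" where
  "max_ratio_set \<rho> \<sigma> =
     {x \<in> set_pmf \<sigma>. \<forall>y\<in>set_pmf \<sigma>. pmf \<rho> y / pmf \<sigma> y \<le> pmf \<rho> x / pmf \<sigma> x}"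

definition r_infty :: "'a::finite pmf \<Rightarrow> 'a pmf \<Rightarrow> ereal" where
  "r_infty \<rho> \<sigma> =
     (if set_pmf \<rho> \<subseteq> set_pmf \<sigma>
      then neg_log (measure_pmf.prob \<sigma> (max_ratio_set \<rho> \<sigma>)) else \<infinity>)"

text \<open>
  A sequence of tests; \<open>T n\<close> is only meaningful on lists of length \<open>n\<close> and is otherwise
  unconstrained.
\<close>

definition test_seq :: "(nat \<Rightarrow> 'a list \<Rightarrow> real) \<Rightarrow> bool" where
  "test_seq T \<longleftrightarrow> (\<forall>n xs. length xs = n \<longrightarrow> T n xs \<in> {0..1})"

definition test_value :: "nat \<Rightarrow> 'a::finite pmf \<Rightarrow> ('a list \<Rightarrow> real) \<Rightarrow> real" where
  "test_value n \<omega> t = (\<Sum>xs | length xs = n. pmf (replicate_pmf n \<omega>) xs * t xs)"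

text \<open>
  The infimum over \<open>R\<close> inside the logarithm is an infimum of reals; it is the intended one for
  non-empty \<open>R\<close>, since all values lie in \<open>[0,1]\<close>. The value at \<open>n = 0\<close> does not affect the limits.
\<close>

definition sc_exponent_set :: "real \<Rightarrow> 'a::finite pmf set \<Rightarrow> 'a pmf \<Rightarrow> ereal" where
  "sc_exponent_set r R \<sigma> =
     Inf {limsup (\<lambda>n. ereal (1 / real n) * neg_log (INF \<rho>\<in>R. test_value n \<rho> (T n))) | T.
            test_seq T \<and>
            liminf (\<lambda>n. ereal (1 / real n) * neg_log (test_value n \<sigma> (T n))) \<ge> ereal r}"

definition sc_exponent :: "real \<Rightarrow> 'a::finite pmf \<Rightarrow> 'a pmf \<Rightarrow> ereal" where
  "sc_exponent r \<rho> \<sigma> = sc_exponent_set r {\<rho>} \<sigma>"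

end

theory Submission
  imports Defs "HOL-Real_Asymp.Real_Asymp"
begin

text \<open>
  The inequality \<open>H\<^sub>r\<^sup>*(\<rho>\<parallel>\<sigma>) \<le> sc\<^sub>r(\<rho>\<parallel>\<sigma>)\<close> is the monotonicity of the Renyi divergence under a
  test, and \<open>sc\<^sub>r(\<rho>\<parallel>\<sigma>) \<le> sc\<^sub>r(R\<parallel>\<sigma>)\<close> for \<open>\<rho> \<in> R\<close> is immediate. The circle is closed by one
  sequence of tests that is good for all \<open>\<rho>\<close> at once: accept a word with probability
  \<open>min(1, exp(-n r) Q/\<sigma>\<^sup>n)\<close>, where \<open>Q\<close> has polynomial total mass and dominates every i.i.d. law.

  If \<open>supp \<rho> \<subseteq> supp \<sigma>\<close>, choose \<open>\<tau>\<close> with \<open>supp \<tau> \<subseteq> supp \<rho>\<close>, \<open>D(\<tau>\<parallel>\<sigma>) \<ge> r\<close> and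
  \<open>D(\<tau>\<parallel>\<rho>) \<le> H\<^sub>r\<^sup>*(\<rho>\<parallel>\<sigma>)\<close>. Jensen's inequality under the law of \<open>\<tau>\<close> bounds the acceptance probability
  below by \<open>exp(-n D(\<tau>\<parallel>\<rho>) - O(sqrt n))\<close>; the error is the mean deviation of a log-likelihood ratio,
  whose variance is bounded in terms of \<open>\<sigma>\<close> alone. Otherwise words leaving \<open>supp \<sigma>\<close>, which are
  always accepted, have probability at least the uniform lower bound on the positive values of \<open>\<rho>\<close>.
\<close>

section \<open>Sums over words of length \<open>n\<close>: total mass, mean and variance of i.i.d.
  sums\<close>

lemma finite_length_eq: "finite {xs :: 'a::finite list. length xs = n}"
  using finite_lists_length_eq[of "UNIV :: 'a set" n] by simp

lemma sum_length_Suc: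
  fixes f :: "'a::finite list \<Rightarrow> 'b::comm_monoid_add"
  shows "(\<Sum>xs | length xs = Suc n. f xs) = (\<Sum>x\<in>UNIV. \<Sum>xs | length xs = n. f (x # xs))"
proof -
  have eq: "{xs :: 'a list. length xs = Suc n} = (\<lambda>(x, xs). x # xs) ` (UNIV \<times> {xs. length xs = n})"
    by (auto simp: length_Suc_conv image_iff)
  show ?thesis
    unfolding eq sum.cartesian_product
    by (subst sum.reindex) (auto simp: inj_on_def split_def)
qed

lemma sum_prod_list_length:
  fixes f :: "'a::finite \<Rightarrow> 'b::comm_semiring_1"
  shows "(\<Sum>xs | length xs = n. prod_list (map f xs)) = (\<Sum>x\<in>UNIV. f x) ^ n"
proof (induction n)
  case (Suc n)
  then show ?case
    by (simp add: sum_length_Suc flip: sum_distrib_left sum_distrib_right)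
qed simp

text \<open>Linearity of expectation, by peeling off the first letter. It makes the mean
  log-likelihood ratio of two product laws exactly \<open>n\<close> times the one-letter
  divergence.\<close>

lemma sum_prod_list_length_mult_sum_list:
  fixes f g :: "'a::finite \<Rightarrow> real"
  assumes "(\<Sum>x\<in>UNIV. f x) = 1"
  shows "(\<Sum>xs | length xs = n. prod_list (map f xs) * sum_list (map g xs)) =
           real n * (\<Sum>x\<in>UNIV. f x * g x)"
proof (induction n)
  case (Suc n)
  have "(\<Sum>xs | length xs = Suc n. prod_list (map f xs) * sum_list (map g xs)) =
      (\<Sum>x\<in>UNIV. f x * g x * (\<Sum>xs | length xs = n. prod_list (map f xs)) +
         f x * (\<Sum>xs | length xs = n. prod_list (map f xs) * sum_list (map g xs)))"
    by (simp add: sum_length_Suc sum_distrib_left sum.distrib algebra_simps)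
  also have "\<dots> = (\<Sum>x\<in>UNIV. f x * g x) + real n * (\<Sum>x\<in>UNIV. f x * g x)"
    unfolding sum.distrib Suc.IH sum_prod_list_length assms
    by (simp add: assms flip: sum_distrib_right)
  finally show ?case by (simp add: algebra_simps)
qed simp

text \<open>Peeling off the first letter leaves a cross term that vanishes because \<open>g\<close>
  is centred under \<open>f\<close>; hence variances of independent letters add.\<close>

lemma sum_prod_list_length_mult_sum_list_square:
  fixes f g :: "'a::finite \<Rightarrow> real"
  assumes "(\<Sum>x\<in>UNIV. f x) = 1" and "(\<Sum>x\<in>UNIV. f x * g x) = 0"
  shows "(\<Sum>xs | length xs = n. prod_list (map f xs) * (sum_list (map g xs))\<^sup>2) =
           real n * (\<Sum>x\<in>UNIV. f x * (g x)\<^sup>2)"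
proof (induction n)
  case (Suc n)
  let ?S = "\<lambda>h. \<Sum>xs | length xs = n. prod_list (map f xs) * h xs"
  have "(\<Sum>xs | length xs = Suc n. prod_list (map f xs) * (sum_list (map g xs))\<^sup>2) =
      (\<Sum>x\<in>UNIV. f x * (g x)\<^sup>2 * (\<Sum>xs | length xs = n. prod_list (map f xs)) +
         2 * (f x * g x) * ?S (\<lambda>xs. sum_list (map g xs)) +
         f x * ?S (\<lambda>xs. (sum_list (map g xs))\<^sup>2))"
    by (simp add: sum_length_Suc sum_distrib_left sum.distrib algebra_simps power2_eq_square)
  also have "\<dots> = (\<Sum>x\<in>UNIV. f x * (g x)\<^sup>2) + real n * (\<Sum>x\<in>UNIV. f x * (g x)\<^sup>2)"
    unfolding sum.distrib Suc.IH sum_prod_list_length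
      sum_prod_list_length_mult_sum_list[OF assms(1)] assms
    by (simp add: assms flip: sum_distrib_right)
  finally show ?case by (simp add: algebra_simps)
qed simp

section \<open>Product densities and test values\<close>

lemma prod_list_map_powr:
  fixes f :: "'a \<Rightarrow> real"
  assumes "\<And>x. f x \<ge> 0"
  shows "prod_list (map f xs) powr a = prod_list (map (\<lambda>x. f x powr a) xs)"
  using assms by (induction xs) (auto simp: powr_mult prod_list_nonneg)

lemma prod_list_map_mult:
  fixes f g :: "'a \<Rightarrow> 'b::comm_monoid_mult"
  shows "prod_list (map (\<lambda>x. f x * g x) xs) = prod_list (map f xs) * prod_list (map g xs)"
  by (induction xs) (auto simp: ac_simps)

lemma pmf_replicate_pmf:
  "length xs = n \<Longrightarrow> pmf (replicate_pmf n p) xs = prod_list (map (pmf p) xs)"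
proof (induction xs arbitrary: n)
  case (Cons x xs)
  \<comment> \<open>As the image of a product law under the injective map
    \<open>(x, xs) \<mapsto> x # xs\<close>, the law has densities that multiply.\<close>
  have eq: "replicate_pmf (Suc m) p = map_pmf (\<lambda>(x, xs). x # xs) (pair_pmf p (replicate_pmf m p))" for m
    by (simp add: pair_pmf_def map_bind_pmf)
  show ?case
    using Cons pmf_map_inj'[of "\<lambda>(x, xs). x # xs" "pair_pmf p (replicate_pmf (length xs) p)" "(x, xs)"]
    unfolding Cons.prems[symmetric] list.size add_0_right add_Suc_right eq
    by (auto simp: pmf_pair inj_def)
qed auto

lemma sum_pmf_UNIV: "(\<Sum>x\<in>UNIV. pmf p x) = 1" for p :: "'a::finite pmf"
  by (rule sum_pmf_eq_1) auto

lemma test_value_eq: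
  "test_value n p t = (\<Sum>xs | length xs = n. prod_list (map (pmf p) xs) * t xs)"
  by (auto simp: test_value_def pmf_replicate_pmf intro!: sum.cong)

lemma prod_list_map_pmf_nonneg: "prod_list (map (pmf p) xs) \<ge> 0"
  by (induction xs) auto

lemma prod_list_map_pmf_pos_iff: "prod_list (map (pmf p) xs) > 0 \<longleftrightarrow> set xs \<subseteq> set_pmf p"
  by (induction xs) (auto simp: zero_less_mult_iff pmf_positive_iff prod_list_map_pmf_nonneg not_less
     prod_list_map_pmf_nonneg[THEN order.antisym[rotated]])

lemma test_value_bounds:
  assumes "test_seq T"
  shows "test_value n p (T n) \<ge> 0" "test_value n p (T n) \<le> 1"
proof -
  have T: "T n xs \<in> {0..1}" if "length xs = n" for xs
    using assms that by (auto simp: test_seq_def)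
  show "test_value n p (T n) \<ge> 0"
    unfolding test_value_eq using T by (intro sum_nonneg mult_nonneg_nonneg prod_list_map_pmf_nonneg) auto
  have "test_value n p (T n) \<le> (\<Sum>xs | length xs = n. prod_list (map (pmf p) xs))"
    unfolding test_value_eq using T by (intro sum_mono mult_left_le prod_list_map_pmf_nonneg) auto
  then show "test_value n p (T n) \<le> 1"
    by (simp add: sum_prod_list_length sum_pmf_UNIV)
qed

section \<open>Lower bounds for the strong converse exponent\<close>

lemma neg_log_antimono:
  assumes "0 \<le> x" "x \<le> y"
  shows "neg_log y \<le> neg_log x"
  using assms by (auto simp: neg_log_def)

lemma neg_log_nonneg: "0 \<le> x \<Longrightarrow> x \<le> 1 \<Longrightarrow> 0 \<le> neg_log x"
  by (auto simp: neg_log_def)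

text \<open>The constraint on a test sequence concerns only \<open>\<sigma>\<close>, so both infima
  run over the same sequences, and the worst case over \<open>R\<close> is at least as bad as the
  single \<open>\<rho>\<close>.\<close>

lemma sc_exponent_le_sc_exponent_set:
  assumes "\<rho> \<in> R"
  shows "sc_exponent r \<rho> \<sigma> \<le> sc_exponent_set r R \<sigma>"
  unfolding sc_exponent_def sc_exponent_set_def
proof (rule Inf_mono, clarify)
  fix T assume T: "test_seq (T :: nat \<Rightarrow> 'a list \<Rightarrow> real)"
    "ereal r \<le> liminf (\<lambda>n. ereal (1 / real n) * neg_log (test_value n \<sigma> (T n)))"
  have "(INF \<rho>\<in>R. test_value n \<rho> (T n)) \<le> test_value n \<rho> (T n)" 
       "0 \<le> (INF \<rho>\<in>R. test_value n \<rho> (T n))" for n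
    using test_value_bounds(1)[OF T(1)] assms
    by (auto intro!: cINF_lower cINF_greatest bdd_belowI2)
  then have "limsup (\<lambda>n. ereal (1 / real n) * neg_log (INF \<rho>\<in>{\<rho>}. test_value n \<rho> (T n)))
      \<le> limsup (\<lambda>n. ereal (1 / real n) * neg_log (INF \<rho>\<in>R. test_value n \<rho> (T n)))"
    by (intro Limsup_mono always_eventually allI ereal_mult_left_mono) (auto intro!: neg_log_antimono)
  with T show "\<exists>a\<in>{limsup (\<lambda>n. ereal (1 / real n) * neg_log (INF \<rho>\<in>{\<rho>}. test_value n \<rho> (T n))) |T.
        test_seq T \<and> ereal r \<le> liminf (\<lambda>n. ereal (1 / real n) * neg_log (test_value n \<sigma> (T n)))}.
     a \<le> limsup (\<lambda>n. ereal (1 / real n) * neg_log (INF \<rho>\<in>R. test_value n \<rho> (T n)))"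
    by blast
qed

text \<open>Convexity of the power function: its graph lies above the tangent at \<open>c\<close>.
  Scaling by \<open>c\<close> reduces this to Bernoulli's inequality.\<close>

lemma powr_ge_tangent:
  fixes t c :: real
  assumes "\<alpha> > 1" "t \<ge> 0" "c > 0"
  shows "t powr \<alpha> \<ge> c powr \<alpha> + \<alpha> * c powr (\<alpha> - 1) * (t - c)"
proof -
  define u where "u = t / c"
  have u: "u \<ge> 0" "t = c * u" using assms by (auto simp: u_def)
  \<comment> \<open>Young's inequality for \<open>u\<close> and \<open>1\<close> with conjugate
    exponents \<open>\<alpha>\<close> and \<open>\<alpha> / (\<alpha> - 1)\<close> is Bernoulli's
    inequality rearranged.\<close>
  have "u * 1 \<le> u powr \<alpha> / \<alpha> + 1 powr (\<alpha> / (\<alpha> - 1)) / (\<alpha> / (\<alpha> - 1))"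
    using assms u by (intro Youngs_inequality) (auto simp: field_simps)
  also have "\<dots> = (u powr \<alpha> + (\<alpha> - 1)) / \<alpha>"
    using assms by (simp add: field_simps)
  finally have *: "1 + \<alpha> * (u - 1) \<le> u powr \<alpha>"
    using assms by (simp add: pos_le_divide_eq algebra_simps)
  have "c powr \<alpha> * (1 + \<alpha> * (u - 1)) \<le> c powr \<alpha> * u powr \<alpha>"
    using * by (intro mult_left_mono) auto
  also have "\<dots> = t powr \<alpha>" using u assms by (simp add: powr_mult)
  finally have "c powr \<alpha> + \<alpha> * (c powr (\<alpha> - 1) * c) * (u - 1) \<le> t powr \<alpha>"
    using assms by (simp add: powr_diff algebra_simps)
  then show ?thesis
    by (simp add: u algebra_simps)
qed

text \<open>Apply the tangent inequality to each ratio \<open>a i / b i\<close> at the ratio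
  \<open>c = A / B\<close> of the totals. The linear terms then sum to a multiple of
  \<open>A - c * B = 0\<close>. The weights \<open>w\<close> will be the values of a test.\<close>

lemma sum_powr_powr_ge:
  fixes a b w :: "'i \<Rightarrow> real"
  assumes "\<alpha> > 1" and nn: "\<And>i. i \<in> I \<Longrightarrow> a i \<ge> 0" "\<And>i. i \<in> I \<Longrightarrow> b i \<ge> 0" "\<And>i. i \<in> I \<Longrightarrow> w i \<ge> 0"
    and abs: "\<And>i. i \<in> I \<Longrightarrow> b i = 0 \<Longrightarrow> a i = 0"
    and A: "A = (\<Sum>i\<in>I. a i * w i)" "A > 0" and B: "B = (\<Sum>i\<in>I. b i * w i)" "B > 0"
  shows "A powr \<alpha> * B powr (1 - \<alpha>) \<le> (\<Sum>i\<in>I. a i powr \<alpha> * b i powr (1 - \<alpha>) * w i)"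
proof -
  define c where "c = A / B"
  have c: "c > 0" using A B by (simp add: c_def)
  have "b i * w i * c powr \<alpha> + \<alpha> * c powr (\<alpha> - 1) * (a i * w i - c * (b i * w i))
      \<le> a i powr \<alpha> * b i powr (1 - \<alpha>) * w i" if i: "i \<in> I" for i
  proof (cases "b i = 0")
    case False
    with nn[OF i] have b: "b i > 0" by auto
    have "b i * w i * c powr \<alpha> + \<alpha> * c powr (\<alpha> - 1) * (a i * w i - c * (b i * w i)) =
        b i * w i * (c powr \<alpha> + \<alpha> * c powr (\<alpha> - 1) * (a i / b i - c))"
      using b by (simp add: field_simps)
    also have "\<dots> \<le> b i * w i * (a i / b i) powr \<alpha>"
      using assms(1) nn[OF i] c by (intro mult_left_mono powr_ge_tangent) auto
    also have "\<dots> = a i powr \<alpha> * b i powr (1 - \<alpha>) * w i"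
      using b nn[OF i] by (simp add: powr_divide powr_diff)
    finally show ?thesis .
  qed (use abs i in auto)
  then have "(\<Sum>i\<in>I. b i * w i * c powr \<alpha> + \<alpha> * c powr (\<alpha> - 1) * (a i * w i - c * (b i * w i)))
     \<le> (\<Sum>i\<in>I. a i powr \<alpha> * b i powr (1 - \<alpha>) * w i)"
    by (rule sum_mono)
  also have "(\<Sum>i\<in>I. b i * w i * c powr \<alpha> + \<alpha> * c powr (\<alpha> - 1) * (a i * w i - c * (b i * w i))) =
     B * c powr \<alpha> + \<alpha> * c powr (\<alpha> - 1) * (A - c * B)"
    by (simp add: A B sum.distrib sum_subtractf flip: sum_distrib_left sum_distrib_right)
  also have "\<dots> = A powr \<alpha> * B powr (1 - \<alpha>)"
    using A(2) B(2) by (simp add: c_def powr_divide powr_diff)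
  finally show ?thesis .
qed

lemma sum_set_pmf_eq_sum_UNIV:
  "(\<Sum>x\<in>set_pmf \<rho>. pmf \<rho> x powr \<alpha> * g x) = (\<Sum>x\<in>UNIV. pmf \<rho> x powr \<alpha> * g x)"
  for \<rho> :: "'a::finite pmf"
  by (rule sum.mono_neutral_left) (auto simp: set_pmf_iff)

text \<open>Data processing for the power sum, keeping only the outcome "accept": since
  \<open>T n \<le> 1\<close>, dropping the test only enlarges the sum over words, which then
  factorises letter by letter.\<close>

lemma test_value_powr_le:
  assumes "test_seq T" "\<alpha> > 1" "set_pmf \<rho> \<subseteq> set_pmf \<sigma>" "test_value n \<rho> (T n) > 0" 
  shows "test_value n \<sigma> (T n) > 0"
    and "test_value n \<rho> (T n) powr \<alpha> * test_value n \<sigma> (T n) powr (1 - \<alpha>)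
      \<le> (\<Sum>x\<in>set_pmf \<rho>. pmf \<rho> x powr \<alpha> * pmf \<sigma> x powr (1 - \<alpha>)) ^ n"
proof -
  have T: "T n xs \<ge> 0" "T n xs \<le> 1" if "length xs = n" for xs
    using assms that by (auto simp: test_seq_def)
  let ?P = "\<lambda>\<rho> xs. prod_list (map (pmf \<rho>) xs)"
  have abs: "?P \<rho> xs = 0" if "?P \<sigma> xs = 0" for xs
    using that prod_list_map_pmf_pos_iff[of \<sigma> xs] prod_list_map_pmf_pos_iff[of \<rho> xs] assms(3)
      prod_list_map_pmf_nonneg[of \<rho> xs] by auto
  have "test_value n \<sigma> (T n) \<noteq> 0"
  proof
    assume "test_value n \<sigma> (T n) = 0"
    then have "\<forall>xs\<in>{xs. length xs = n}. ?P \<sigma> xs * T n xs = 0"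
      unfolding test_value_eq using T
      by (subst (asm) sum_nonneg_eq_0_iff) (auto simp: finite_length_eq prod_list_map_pmf_nonneg)
    then have "test_value n \<rho> (T n) = 0"
      unfolding test_value_eq using abs by (intro sum.neutral) auto
    with assms show False by simp
  qed
  with test_value_bounds[OF assms(1)] show pos: "test_value n \<sigma> (T n) > 0"
    by (simp add: order.strict_iff_order)
  have "test_value n \<rho> (T n) powr \<alpha> * test_value n \<sigma> (T n) powr (1 - \<alpha>)
      \<le> (\<Sum>xs | length xs = n. ?P \<rho> xs powr \<alpha> * ?P \<sigma> xs powr (1 - \<alpha>) * T n xs)"
    using assms T abs pos
    by (intro sum_powr_powr_ge) (auto simp: test_value_eq prod_list_map_pmf_nonneg)
  also have "\<dots> \<le> (\<Sum>xs | length xs = n. ?P \<rho> xs powr \<alpha> * ?P \<sigma> xs powr (1 - \<alpha>))"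
    using T by (intro sum_mono mult_left_le) auto
  also have "\<dots> = (\<Sum>xs | length xs = n. prod_list (map (\<lambda>x. pmf \<rho> x powr \<alpha> * pmf \<sigma> x powr (1 - \<alpha>)) xs))"
    by (simp add: prod_list_map_powr prod_list_map_mult)
  also have "\<dots> = (\<Sum>x\<in>set_pmf \<rho>. pmf \<rho> x powr \<alpha> * pmf \<sigma> x powr (1 - \<alpha>)) ^ n"
    by (simp add: sum_prod_list_length sum_set_pmf_eq_sum_UNIV)
  finally show "test_value n \<rho> (T n) powr \<alpha> * test_value n \<sigma> (T n) powr (1 - \<alpha>)
      \<le> (\<Sum>x\<in>set_pmf \<rho>. pmf \<rho> x powr \<alpha> * pmf \<sigma> x powr (1 - \<alpha>)) ^ n" .
qed

text \<open>The logarithm of the data-processing bound at fixed \<open>n\<close>. Since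
  \<open>ln (Z \<alpha>)\<close> is \<open>\<alpha> - 1\<close> times the Renyi divergence, the left
  side is the \<open>\<alpha>\<close>-term of the anti-divergence with the rate \<open>y\<close> in
  place of \<open>r\<close>.\<close>

lemma neg_log_test_value_ge:
  fixes \<rho> \<sigma> :: "'a::finite pmf"
  defines "Z \<equiv> (\<lambda>\<alpha>. \<Sum>x\<in>set_pmf \<rho>. pmf \<rho> x powr \<alpha> * pmf \<sigma> x powr (1 - \<alpha>))"
  assumes "test_seq T" "\<alpha> > 1" "set_pmf \<rho> \<subseteq> set_pmf \<sigma>" "n > 0"
    and "ereal y \<le> ereal (1 / real n) * neg_log (test_value n \<sigma> (T n))"
  shows "ereal ((\<alpha> - 1) / \<alpha> * y - ln (Z \<alpha>) / \<alpha>)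
           \<le> ereal (1 / real n) * neg_log (test_value n \<rho> (T n))"
proof (cases "test_value n \<rho> (T n) = 0")
  case True
  then show ?thesis using assms(5) by (simp add: neg_log_def)
next
  case False
  let ?p = "test_value n \<rho> (T n)" and ?q = "test_value n \<sigma> (T n)"
  have p: "?p > 0" using False test_value_bounds(1)[OF assms(2), of n \<rho>] by simp
  note b = test_value_powr_le[OF assms(2-4) p]
  have q: "?q > 0" by (rule b)
  have le: "?p powr \<alpha> * ?q powr (1 - \<alpha>) \<le> Z \<alpha> ^ n" using b(2) by (simp add: Z_def)
  have Z: "Z \<alpha> > 0"
    unfolding Z_def using assms(4) by (intro sum_pos) (auto simp: zero_less_mult_iff set_pmf_iff set_pmf_not_empty)
  have "\<alpha> * ln ?p + (1 - \<alpha>) * ln ?q = ln (?p powr \<alpha> * ?q powr (1 - \<alpha>))"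
    using p q by (simp add: ln_mult_pos ln_powr)
  also have "\<dots> \<le> ln (Z \<alpha> ^ n)" using le p q Z by (intro ln_mono) auto
  also have "\<dots> = n * ln (Z \<alpha>)" using Z by (simp add: ln_realpow)
  finally have 1: "\<alpha> * ln ?p + (1 - \<alpha>) * ln ?q \<le> n * ln (Z \<alpha>)" .
  have "y \<le> - ln ?q / n" using assms(6) q by (simp add: neg_log_def)
  then have "(\<alpha> - 1) * (y * n) \<le> (\<alpha> - 1) * (- ln ?q)"
    using assms(3,5) by (intro mult_left_mono) (auto simp: field_simps)
  with 1 have "((\<alpha> - 1) * y - ln (Z \<alpha>)) * n \<le> \<alpha> * (- ln ?p)" by (simp add: algebra_simps)
  then have "((\<alpha> - 1) * y - ln (Z \<alpha>)) / \<alpha> \<le> - ln ?p / n"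
    using assms(3,5) by (simp add: field_simps)
  then have "(\<alpha> - 1) / \<alpha> * y - ln (Z \<alpha>) / \<alpha> \<le> - ln ?p / n"
    by (simp only: diff_divide_distrib[symmetric] times_divide_eq_left)
  then show ?thesis using p by (simp add: neg_log_def)
qed

lemma hoeffding_anti_div_le_sc_exponent:
  "hoeffding_anti_div r \<rho> \<sigma> \<le> sc_exponent r \<rho> \<sigma>"
  unfolding sc_exponent_def sc_exponent_set_def
proof (rule Inf_greatest, clarify)
  fix T assume T: "test_seq (T :: nat \<Rightarrow> 'a list \<Rightarrow> real)"
    "ereal r \<le> liminf (\<lambda>n. ereal (1 / real n) * neg_log (test_value n \<sigma> (T n)))"
  let ?L = "limsup (\<lambda>n. ereal (1 / real n) * neg_log (test_value n \<rho> (T n)))"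
  \<comment> \<open>Test values lie in \<open>[0,1]\<close>; this accounts for the maximum with 0 in
    the anti-divergence.\<close>
  have 0: "0 \<le> ?L"
    using test_value_bounds[OF T(1)]
    by (intro order.trans[OF _ Liminf_le_Limsup] Liminf_bounded always_eventually allI
         ereal_0_le_mult neg_log_nonneg) auto
  have "ereal ((\<alpha> - 1) / \<alpha>) * (ereal r - renyi_div \<alpha> \<rho> \<sigma>) \<le> ?L" if \<alpha>: "\<alpha> > 1" for \<alpha>
  proof (cases "set_pmf \<rho> \<subseteq> set_pmf \<sigma>")
    case False
    then show ?thesis using \<alpha> 0 by (simp add: renyi_div_def)
  next
    case True
    define c where "c = ln (\<Sum>x\<in>set_pmf \<rho>. pmf \<rho> x powr \<alpha> * pmf \<sigma> x powr (1 - \<alpha>))"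
    \<comment> \<open>The constraint on the liminf yields a rate above \<open>y\<close> for all
      large \<open>n\<close> only when \<open>y < r\<close>; the bound at \<open>r\<close> itself
      follows by letting \<open>y\<close> tend to \<open>r\<close> from the left.\<close>
    have "ereal ((\<alpha> - 1) / \<alpha> * y - c / \<alpha>) \<le> ?L" if "y < r" for y
    proof -
      have "ereal y < liminf (\<lambda>n. ereal (1 / real n) * neg_log (test_value n \<sigma> (T n)))"
        using T(2) that by (meson ereal_less_ereal_Ex less_ereal.simps(1) order_less_le_trans)
      then have "\<forall>\<^sub>F n in sequentially. ereal y < ereal (1 / real n) * neg_log (test_value n \<sigma> (T n))"
        by (rule less_LiminfD)
      then have "\<forall>\<^sub>F n in sequentially. ereal ((\<alpha> - 1) / \<alpha> * y - c / \<alpha>) 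
            \<le> ereal (1 / real n) * neg_log (test_value n \<rho> (T n))"
        using eventually_gt_at_top[of 0] unfolding c_def
        by eventually_elim (intro neg_log_test_value_ge T True \<alpha>; simp)
      then show ?thesis
        by (intro order.trans[OF _ Liminf_le_Limsup] Liminf_bounded) auto
    qed note * = this
    have "ereal ((\<alpha> - 1) / \<alpha> * r - c / \<alpha>) \<le> ?L"
    proof (rule tendsto_upperbound[where F = "at_left r" and f = "\<lambda>y. ereal ((\<alpha> - 1) / \<alpha> * y - c / \<alpha>)"])
      show "((\<lambda>y. ereal ((\<alpha> - 1) / \<alpha> * y - c / \<alpha>)) \<longlongrightarrow> ereal ((\<alpha> - 1) / \<alpha> * r - c / \<alpha>)) (at_left r)"
        by (intro tendsto_intros)
      show "\<forall>\<^sub>F y in at_left r. ereal ((\<alpha> - 1) / \<alpha> * y - c / \<alpha>) \<le> ?L"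
        unfolding eventually_at_filter using * by (intro always_eventually) auto
    qed auto
    moreover have "ereal ((\<alpha> - 1) / \<alpha>) * (ereal r - renyi_div \<alpha> \<rho> \<sigma>) = ereal ((\<alpha> - 1) / \<alpha> * r - c / \<alpha>)"
      using True \<alpha> by (simp add: renyi_div_def c_def field_simps)
    ultimately show ?thesis by simp
  qed
  then have "hoeffding_anti_div r \<rho> \<sigma> \<le> ?L"
    unfolding hoeffding_anti_div_def using 0 by (auto intro!: SUP_least)
  then show "hoeffding_anti_div r \<rho> \<sigma> \<le> limsup (\<lambda>n. ereal (1 / real n) * neg_log (INF \<rho>\<in>{\<rho>}. test_value n \<rho> (T n)))"
    by simp
qed

section \<open>The universal test and its error under \<open>\<sigma>\<close>\<close>

text \<open>
  An i.i.d. law is constant on the permutation class of a word, so it gives each word of the class at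
  most the reciprocal of the size of the class. These bounds sum to the number of classes only, which
  is polynomial in the length.
\<close>

definition type_weight :: "'a list \<Rightarrow> real" where
  "type_weight xs = 1 / real (card {ys. mset ys = mset xs})"

lemma finite_mset_class: "finite {ys :: 'a::finite list. mset ys = mset xs}"
  by (rule finite_subset[OF _ finite_length_eq[of "length xs"]]) (auto dest: mset_eq_length)

lemma card_mset_class_pos: "card {ys :: 'a::finite list. mset ys = mset xs} > 0"
  using finite_mset_class[of xs] by (auto simp: card_gt_0_iff)

lemma prod_list_pmf_le_type_weight:
  "prod_list (map (pmf p) xs) \<le> type_weight xs" for p :: "'a::finite pmf"
proof -
  let ?C = "{ys. mset ys = mset xs}"
  have "real (card ?C) * prod_list (map (pmf p) xs) = (\<Sum>ys\<in>?C. prod_list (map (pmf p) ys))"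
  proof -
    have "prod_list (map (pmf p) ys) = prod_list (map (pmf p) xs)" if "mset ys = mset xs" for ys
      using that by (metis mset_map prod_mset_prod_list)
    then have "(\<Sum>ys\<in>?C. prod_list (map (pmf p) ys)) = (\<Sum>ys\<in>?C. prod_list (map (pmf p) xs))"
      by (intro sum.cong) blast+
    also have "\<dots> = real (card ?C) * prod_list (map (pmf p) xs)" by simp
    finally show ?thesis by (rule sym)
  qed
  also have "\<dots> \<le> (\<Sum>ys | length ys = length xs. prod_list (map (pmf p) ys))"
    by (intro sum_mono2) (auto simp: finite_length_eq prod_list_map_pmf_nonneg dest: mset_eq_length)
  also have "\<dots> = 1" by (simp add: sum_prod_list_length sum_pmf_UNIV)
  finally show ?thesis
    using card_mset_class_pos[of xs] by (simp add: type_weight_def field_simps)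
qed

lemma sum_type_weight_le:
  "(\<Sum>xs :: 'a::finite list | length xs = n. type_weight xs) \<le> (real n + 1) ^ CARD('a)"
proof -
  let ?X = "{xs :: 'a list. length xs = n}"
  have class_sum: "(\<Sum>xs | xs \<in> ?X \<and> mset xs = M. type_weight xs) = 1" if M: "M \<in> mset ` ?X" for M
  proof -
    obtain ys where ys: "length ys = n" "M = mset ys" using M by auto
    then have "{xs. xs \<in> ?X \<and> mset xs = M} = {xs. mset xs = mset ys}"
      by (auto dest: mset_eq_length)
    moreover have "type_weight xs = type_weight ys" if "mset xs = mset ys" for xs :: "'a list"
      using that by (simp add: type_weight_def)
    ultimately have "(\<Sum>xs | xs \<in> ?X \<and> mset xs = M. type_weight xs) =
        (\<Sum>xs | mset xs = mset ys. type_weight ys)"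
      by (intro sum.cong) blast+
    then show ?thesis using card_mset_class_pos[of ys] by (simp add: type_weight_def)
  qed
  \<comment> \<open>A permutation class is determined by its letter counts, each of which takes one
    of the \<open>n + 1\<close> values \<open>0, ..., n\<close>.\<close>
  have "card (mset ` ?X) \<le> card ((UNIV :: 'a set) \<rightarrow>\<^sub>E {..n})"
  proof (rule card_inj_on_le[where f = count])
    show "inj_on count (mset ` ?X)" by (auto simp: inj_on_def count_inject)
    show "count ` mset ` ?X \<subseteq> UNIV \<rightarrow>\<^sub>E {..n}"
      by (auto simp: PiE_def count_mset intro: order.trans[OF count_le_length])
  qed (simp add: finite_PiE)
  then have le: "real (card (mset ` ?X)) \<le> real (card ((UNIV :: 'a set) \<rightarrow>\<^sub>E {..n}))"
    by simp
  have "(\<Sum>xs\<in>?X. type_weight xs) =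
      (\<Sum>M\<in>mset ` ?X. \<Sum>xs | xs \<in> ?X \<and> mset xs = M. type_weight xs)"
    by (rule sum.image_gen[OF finite_length_eq])
  also have "\<dots> = (\<Sum>M\<in>mset ` ?X. 1)"
    by (intro sum.cong refl class_sum)
  also have "\<dots> \<le> real (card ((UNIV :: 'a set) \<rightarrow>\<^sub>E {..n}))"
    using le by simp
  also have "\<dots> = (real n + 1) ^ CARD('a)"
    by (simp add: card_funcsetE add.commute)
  finally show ?thesis .
qed

text \<open>Accepting words that \<open>\<sigma>\<close> cannot produce costs nothing. On all other
  words the division by \<open>s\<close> cancels the density of \<open>\<sigma>\<close>, so a word
  contributes at most \<open>exp (- (n * r)) * type_weight xs\<close> to the error.\<close>

definition universal_test :: "real \<Rightarrow> 'a::finite pmf \<Rightarrow> nat \<Rightarrow> 'a list \<Rightarrow> real" where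
  "universal_test r \<sigma> n xs =
     (let s = prod_list (map (pmf \<sigma>) xs)
      in if s = 0 then 1 else min 1 (exp (- (real n * r)) * type_weight xs / s))"

lemma universal_test_nonneg: "universal_test r \<sigma> n xs \<ge> 0"
  by (auto simp: universal_test_def Let_def type_weight_def prod_list_map_pmf_nonneg)

lemma test_seq_universal_test: "test_seq (universal_test r \<sigma>)"
  by (auto simp: test_seq_def universal_test_def Let_def prod_list_map_pmf_nonneg type_weight_def)

lemma test_value_universal_test_le:
  "test_value n \<sigma> (universal_test r \<sigma> n) \<le> exp (- (real n * r)) * (real n + 1) ^ CARD('a)"
  for \<sigma> :: "'a::finite pmf"
proof -
  have "test_value n \<sigma> (universal_test r \<sigma> n) \<le>
      (\<Sum>xs :: 'a list | length xs = n. exp (- (real n * r)) * type_weight xs)"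
    unfolding test_value_eq
  proof (rule sum_mono)
    fix xs :: "'a list"
    have "prod_list (map (pmf \<sigma>) xs) * universal_test r \<sigma> n xs \<le>
       prod_list (map (pmf \<sigma>) xs) * (exp (- (real n * r)) * type_weight xs / prod_list (map (pmf \<sigma>) xs))"
      if "prod_list (map (pmf \<sigma>) xs) \<noteq> 0"
      using that by (intro mult_left_mono prod_list_map_pmf_nonneg) (auto simp: universal_test_def)
    then show "prod_list (map (pmf \<sigma>) xs) * universal_test r \<sigma> n xs \<le>
        exp (- (real n * r)) * type_weight xs"
      by (cases "prod_list (map (pmf \<sigma>) xs) = 0") (auto simp: type_weight_def)
  qed
  also have "\<dots> \<le> exp (- (real n * r)) * (real n + 1) ^ CARD('a)"
    unfolding sum_distrib_left[symmetric] by (intro mult_left_mono sum_type_weight_le) auto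
  finally show ?thesis .
qed

text \<open>The polynomial total of \<open>type_weight\<close> lowers the rate only by a multiple of
  \<open>ln (n + 1) / n\<close>, so the constraint is met at \<open>r\<close> itself.\<close>

lemma liminf_universal_test_ge:
  "liminf (\<lambda>n. ereal (1 / real n) * neg_log (test_value n \<sigma> (universal_test r \<sigma> n))) \<ge> ereal r"
  for \<sigma> :: "'a::finite pmf"
proof -
  let ?f = "\<lambda>n. r - real CARD('a) * (ln (real n + 1) / real n)"
  have "(\<lambda>n. ln (real n + 1) / real n) \<longlonglongrightarrow> 0" by real_asymp
  then have "?f \<longlonglongrightarrow> r - real CARD('a) * 0" by (intro tendsto_intros)
  then have "(\<lambda>n. ereal (?f n)) \<longlonglongrightarrow> ereal r" by simp
  then have "ereal r = liminf (\<lambda>n. ereal (?f n))"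
    by (intro lim_imp_Liminf[symmetric]) auto
  also have "\<dots> \<le> liminf (\<lambda>n. ereal (1 / real n) * neg_log (test_value n \<sigma> (universal_test r \<sigma> n)))"
  proof (rule Liminf_mono)
    show "\<forall>\<^sub>F n in sequentially. ereal (?f n) \<le> ereal (1 / real n) * neg_log (test_value n \<sigma> (universal_test r \<sigma> n))"
      using eventually_gt_at_top[of 0]
    proof eventually_elim
      case (elim n)
      let ?q = "test_value n \<sigma> (universal_test r \<sigma> n)"
      show ?case
      proof (cases "?q = 0")
        case True
        then show ?thesis using elim by (simp add: neg_log_def)
      next
        case False
        then have q: "?q > 0" using test_value_bounds(1)[OF test_seq_universal_test, of n \<sigma> r \<sigma>] by simp
        then have "ln ?q \<le> ln (exp (- (real n * r)) * (real n + 1) ^ CARD('a))"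
          using test_value_universal_test_le by (intro ln_mono) auto
        also have "\<dots> = - (real n * r) + real CARD('a) * ln (real n + 1)"
          by (subst ln_mult_pos) (auto simp: ln_realpow)
        finally have "(real n * r - real CARD('a) * ln (real n + 1)) / real n \<le> - ln ?q / real n"
          by (intro divide_right_mono) auto
        then show ?thesis using elim q by (simp add: neg_log_def diff_divide_distrib)
      qed
    qed
  qed
  finally show ?thesis .
qed

section \<open>Acceptance probability of the universal test under \<open>\<rho>\<close>\<close>

text \<open>Words whose first letter lies outside the support of \<open>\<sigma>\<close> are all
  accepted, and already they have probability at least \<open>\<delta>\<close>.\<close>

lemma universal_test_value_ge_outside:
  fixes \<rho> \<sigma> :: "'a::finite pmf"
  assumes "\<delta> > 0" "\<And>x. x \<in> set_pmf \<rho> \<Longrightarrow> \<delta> \<le> pmf \<rho> x" "\<not> set_pmf \<rho> \<subseteq> set_pmf \<sigma>" "n > 0"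
  shows "test_value n \<rho> (universal_test r \<sigma> n) \<ge> \<delta>"
proof -
  obtain x where x: "x \<in> set_pmf \<rho>" "x \<notin> set_pmf \<sigma>" using assms(3) by auto
  obtain m where m: "n = Suc m" using assms(4) by (cases n) auto
  note nn = prod_list_map_pmf_nonneg
  have "\<delta> \<le> pmf \<rho> x * (\<Sum>xs | length xs = m. prod_list (map (pmf \<rho>) xs))"
    using assms(2)[OF x(1)] by (simp add: sum_prod_list_length sum_pmf_UNIV)
  also have "\<dots> = (\<Sum>xs | length xs = m. prod_list (map (pmf \<rho>) (x # xs)) * universal_test r \<sigma> n (x # xs))"
    using x(2) by (simp add: universal_test_def set_pmf_iff sum_distrib_left)
  also have "\<dots> \<le> (\<Sum>x\<in>UNIV. \<Sum>xs | length xs = m. prod_list (map (pmf \<rho>) (x # xs)) * universal_test r \<sigma> n (x # xs))"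
    by (rule member_le_sum) (auto intro!: sum_nonneg mult_nonneg_nonneg nn universal_test_nonneg)
  also have "\<dots> = test_value n \<rho> (universal_test r \<sigma> n)"
    unfolding test_value_eq m by (simp add: sum_length_Suc)
  finally show ?thesis .
qed

text \<open>Keeps second moments of \<open>ln \<tau>\<close> bounded however small the values of
  \<open>\<tau>\<close> are. The constant comes from \<open>- ln t \<le> 2 / sqrt t\<close>, which
  is \<open>ln u \<le> u - 1\<close> at \<open>u = 1 / sqrt t\<close>.\<close>

lemma mult_ln_square_le:
  fixes t :: real
  assumes "0 \<le> t" "t \<le> 1"
  shows "t * (ln t)\<^sup>2 \<le> 4"
proof (cases "t = 0")
  case False
  with assms have t: "t > 0" by simp
  have "- ln (sqrt t) \<le> 1 / sqrt t - 1"
    using ln_le_minus_one[of "1 / sqrt t"] t by (simp add: ln_div)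
  then have "- ln t \<le> 2 * (1 / sqrt t)" using t by (simp add: ln_sqrt)
  then have "- ln t * sqrt t \<le> 2 * (1 / sqrt t) * sqrt t" using t by (intro mult_right_mono) auto
  then have "- ln t * sqrt t \<le> 2" using t by simp
  moreover have "0 \<le> - ln t * sqrt t" using t assms by (simp add: mult_nonpos_nonneg)
  ultimately have "(- ln t * sqrt t)\<^sup>2 \<le> 2\<^sup>2" by (intro power_mono)
  then show ?thesis using t by (simp add: power_mult_distrib mult.commute)
qed auto

text \<open>The bound is free of \<open>\<tau>\<close>, which makes the later error term uniform
  over \<open>R\<close>. The variance is at most the second moment; splitting the logarithm with
  \<open>(a - b)^2 \<le> 2 a^2 + 2 b^2\<close> leaves \<open>2 * 4\<close> from
  \<open>mult_ln_square_le\<close> and a term in \<open>\<sigma>\<close>.\<close>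

lemma variance_log_ratio_le:
  fixes \<tau> \<sigma> :: "'a::finite pmf"
  assumes "set_pmf \<tau> \<subseteq> set_pmf \<sigma>"
  defines "l \<equiv> (\<lambda>x. ln (pmf \<tau> x / pmf \<sigma> x))"
  shows "(\<Sum>x\<in>UNIV. pmf \<tau> x * (l x - (\<Sum>y\<in>UNIV. pmf \<tau> y * l y))\<^sup>2)
           \<le> (\<Sum>x\<in>UNIV. 8 + 2 * (ln (pmf \<sigma> x))\<^sup>2)"
proof -
  define m where "m = (\<Sum>y\<in>UNIV. pmf \<tau> y * l y)"
  have "(\<Sum>x\<in>UNIV. pmf \<tau> x * (l x - m)\<^sup>2) =
      (\<Sum>x\<in>UNIV. pmf \<tau> x * (l x)\<^sup>2 - 2 * m * (pmf \<tau> x * l x) + m\<^sup>2 * pmf \<tau> x)"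
    by (intro sum.cong) (auto simp: algebra_simps power2_eq_square)
  also have "\<dots> = (\<Sum>x\<in>UNIV. pmf \<tau> x * (l x)\<^sup>2) - m\<^sup>2"
    unfolding sum.distrib sum_subtractf sum_distrib_left[symmetric] sum_pmf_UNIV m_def[symmetric]
    by (simp add: power2_eq_square)
  also have "\<dots> \<le> (\<Sum>x\<in>UNIV. pmf \<tau> x * (l x)\<^sup>2)" by simp
  also have "\<dots> \<le> (\<Sum>x\<in>UNIV. 8 + 2 * (ln (pmf \<sigma> x))\<^sup>2)"
  proof (rule sum_mono)
    fix x
    show "pmf \<tau> x * (l x)\<^sup>2 \<le> 8 + 2 * (ln (pmf \<sigma> x))\<^sup>2"
    proof (cases "x \<in> set_pmf \<tau>")
      case False
      then show ?thesis by (simp add: set_pmf_iff)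
    next
      case True
      then have "pmf \<tau> x > 0" "pmf \<sigma> x > 0" using assms(1) by (auto simp: pmf_positive_iff)
      then have l: "l x = ln (pmf \<tau> x) - ln (pmf \<sigma> x)" by (simp add: l_def ln_div)
      have "(ln (pmf \<tau> x) - ln (pmf \<sigma> x))\<^sup>2 + (ln (pmf \<tau> x) + ln (pmf \<sigma> x))\<^sup>2 =
          2 * (ln (pmf \<tau> x))\<^sup>2 + 2 * (ln (pmf \<sigma> x))\<^sup>2"
        by (simp add: power2_eq_square algebra_simps)
      then have "(l x)\<^sup>2 \<le> 2 * (ln (pmf \<tau> x))\<^sup>2 + 2 * (ln (pmf \<sigma> x))\<^sup>2"
        using zero_le_power2[of "ln (pmf \<tau> x) + ln (pmf \<sigma> x)"] unfolding l by linarith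
      then have "pmf \<tau> x * (l x)\<^sup>2 \<le> pmf \<tau> x * (2 * (ln (pmf \<tau> x))\<^sup>2 + 2 * (ln (pmf \<sigma> x))\<^sup>2)"
        by (intro mult_left_mono) auto
      also have "\<dots> = 2 * (pmf \<tau> x * (ln (pmf \<tau> x))\<^sup>2) + pmf \<tau> x * (2 * (ln (pmf \<sigma> x))\<^sup>2)"
        by (simp add: algebra_simps)
      also have "\<dots> \<le> 2 * 4 + 1 * (2 * (ln (pmf \<sigma> x))\<^sup>2)"
        by (intro add_mono mult_left_mono mult_right_mono mult_ln_square_le) (auto simp: pmf_le_1)
      finally show ?thesis by simp
    qed
  qed
  finally show ?thesis by (simp add: m_def)
qed

text \<open>Change of measure to \<open>\<tau>\<close>: on its support the other densities are that
  of \<open>\<tau>\<close> times the exponential of a log ratio. Since \<open>type_weight\<close>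
  dominates the density of \<open>\<tau>\<close>, the test is at least the clipped likelihood ratio
  of \<open>\<tau>\<close> to \<open>\<sigma>\<close>.\<close>

lemma universal_test_term_ge:
  fixes \<rho> \<sigma> \<tau> :: "'a::finite pmf"
  assumes "set_pmf \<tau> \<subseteq> set_pmf \<rho>" "set_pmf \<rho> \<subseteq> set_pmf \<sigma>"
  shows "prod_list (map (pmf \<rho>) xs) * universal_test r \<sigma> n xs \<ge> prod_list (map (pmf \<tau>) xs) *
      exp (- sum_list (map (\<lambda>x. ln (pmf \<tau> x / pmf \<rho> x)) xs)
           - max 0 (real n * r - sum_list (map (\<lambda>x. ln (pmf \<tau> x / pmf \<sigma> x)) xs)))"
    (is "_ \<ge> ?t * exp (- ?d - max 0 (?n - ?l))")
proof (cases "set xs \<subseteq> set_pmf \<tau>")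
  case False
  then have "?t = 0" using prod_list_map_pmf_pos_iff[of \<tau> xs] prod_list_map_pmf_nonneg[of \<tau> xs] by simp
  then show ?thesis by (simp add: prod_list_map_pmf_nonneg universal_test_nonneg)
next
  case True
  have exp_eq: "prod_list (map (pmf \<tau>) ys) * exp (- sum_list (map (\<lambda>x. ln (pmf \<tau> x / pmf \<omega> x)) ys)) =
      prod_list (map (pmf \<omega>) ys)"
    if "set ys \<subseteq> set_pmf \<tau>" "set_pmf \<tau> \<subseteq> set_pmf \<omega>" for ys and \<omega> :: "'a pmf"
    using that
  proof (induction ys)
    case (Cons y ys)
    then have "pmf \<tau> y > 0" "pmf \<omega> y > 0" by (auto simp: pmf_positive_iff)
    then have "pmf \<tau> y * exp (- ln (pmf \<tau> y / pmf \<omega> y)) = pmf \<omega> y"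
      by (simp add: exp_minus field_simps)
    with Cons show ?case by (simp add: exp_diff exp_minus field_simps)
  qed simp
  have \<rho>: "prod_list (map (pmf \<rho>) xs) = ?t * exp (- ?d)" using exp_eq[OF True assms(1)] by simp
  have \<sigma>: "prod_list (map (pmf \<sigma>) xs) = ?t * exp (- ?l)" using exp_eq[OF True] assms by simp
  have t: "?t > 0" using True by (simp add: prod_list_map_pmf_pos_iff)
  have "exp (- max 0 (?n - ?l)) = min 1 (exp (- ?n) * exp ?l)"
    by (auto simp: max_def min_def simp flip: exp_add)
  also have "exp (- ?n) * exp ?l = exp (- ?n) * ?t / (?t * exp (- ?l))"
    using t by (simp add: exp_minus field_simps)
  also have "min 1 \<dots> \<le> min 1 (exp (- ?n) * type_weight xs / (?t * exp (- ?l)))"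
    using t by (intro min.mono divide_right_mono mult_left_mono prod_list_pmf_le_type_weight) auto
  also have "\<dots> = universal_test r \<sigma> n xs" using t by (simp add: universal_test_def \<sigma>)
  finally have "?t * exp (- ?d) * exp (- max 0 (?n - ?l)) \<le> ?t * exp (- ?d) * universal_test r \<sigma> n xs"
    using t by (intro mult_left_mono) auto
  then show ?thesis by (simp add: \<rho> exp_diff exp_minus field_simps)
qed

text \<open>Jensen's inequality for \<open>exp\<close>, from the tangent at the mean
  \<open>m\<close>.\<close>

lemma sum_weighted_exp_ge:
  fixes w y :: "'i \<Rightarrow> real"
  assumes "\<And>i. i \<in> I \<Longrightarrow> w i \<ge> 0" "(\<Sum>i\<in>I. w i) = 1"
  shows "exp (\<Sum>i\<in>I. w i * y i) \<le> (\<Sum>i\<in>I. w i * exp (y i))"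
proof -
  define m where "m = (\<Sum>i\<in>I. w i * y i)"
  have "(\<Sum>i\<in>I. w i * (exp m * (1 + (y i - m)))) \<le> (\<Sum>i\<in>I. w i * exp (y i))"
  proof (intro sum_mono mult_left_mono assms)
    fix i
    have "exp m * (1 + (y i - m)) \<le> exp m * exp (y i - m)"
      by (intro mult_left_mono exp_ge_add_one_self) auto
    then show "exp m * (1 + (y i - m)) \<le> exp (y i)" by (simp flip: exp_add)
  qed
  also have "(\<Sum>i\<in>I. w i * (exp m * (1 + (y i - m)))) =
      (\<Sum>i\<in>I. exp m * ((1 - m) * w i) + exp m * (w i * y i))"
    by (intro sum.cong) (auto simp: algebra_simps)
  also have "\<dots> = exp m * (1 - m) + exp m * m"
    unfolding sum.distrib sum_distrib_left[symmetric] assms(2) m_def by simp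
  finally show ?thesis by (simp add: m_def algebra_simps)
qed

text \<open>After Jensen's inequality the exponent is a mean of two parts: the log ratio to
  \<open>\<rho>\<close>, evaluated exactly, and the shortfall of the log ratio to
  \<open>\<sigma>\<close> below \<open>n * r\<close>, controlled by its variance.\<close>

lemma universal_test_value_ge:
  fixes \<rho> \<sigma> \<tau> :: "'a::finite pmf"
  assumes supp: "set_pmf \<tau> \<subseteq> set_pmf \<rho>" "set_pmf \<rho> \<subseteq> set_pmf \<sigma>"
    and r: "r \<le> (\<Sum>x\<in>UNIV. pmf \<tau> x * ln (pmf \<tau> x / pmf \<sigma> x))" and "n > 0"
  defines "V \<equiv> \<Sum>x\<in>UNIV. 8 + 2 * (ln (pmf \<sigma> x))\<^sup>2"
  shows "test_value n \<rho> (universal_test r \<sigma> n) \<ge>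
     exp (- (real n * (\<Sum>x\<in>UNIV. pmf \<tau> x * ln (pmf \<tau> x / pmf \<rho> x))) - sqrt (real n) * (V + 1) / 2)"
proof -
  define d where "d = (\<lambda>x. ln (pmf \<tau> x / pmf \<rho> x))"
  define l where "l = (\<lambda>x. ln (pmf \<tau> x / pmf \<sigma> x))"
  define m where "m = (\<Sum>x\<in>UNIV. pmf \<tau> x * l x)"
  define t where "t = (\<lambda>xs. prod_list (map (pmf \<tau>) xs))"
  let ?S = "\<lambda>h. \<Sum>xs | length xs = n. t xs * h xs"
  have t0: "t xs \<ge> 0" for xs by (simp add: t_def prod_list_map_pmf_nonneg)
  have t1: "(\<Sum>xs | length xs = n. t xs) = 1"
    by (simp add: t_def sum_prod_list_length sum_pmf_UNIV)
  \<comment> \<open>Bounding \<open>\<bar>z\<bar>\<close> by \<open>z^2 / (2 * s) + s / 2\<close>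
    needs only a second moment. As that moment is \<open>n * W\<close>, the choice
    \<open>s = sqrt n\<close> makes both terms of order \<open>sqrt n\<close>.\<close>
  define s where "s = sqrt (real n)"
  have s: "s > 0" "real n = s * s" using \<open>n > 0\<close> by (simp_all add: s_def)
  have dev: "max 0 (real n * r - sum_list (map l xs)) \<le>
      (sum_list (map (\<lambda>x. l x - m) xs))\<^sup>2 / (2 * s) + s / 2" if "length xs = n" for xs
  proof -
    define z where "z = sum_list (map (\<lambda>x. l x - m) xs)"
    have z: "sum_list (map l xs) = z + real n * m"
      using that by (simp add: z_def sum_list_subtractf sum_list_triv)
    \<comment> \<open>The mean log ratio is at least \<open>n * r\<close>, so any shortfall is at
      most the deviation \<open>\<bar>z\<bar>\<close> from the mean.\<close>
    have "real n * r \<le> real n * m" using r by (simp add: m_def l_def mult_left_mono)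
    then have "max 0 (real n * r - sum_list (map l xs)) \<le> \<bar>z\<bar>" unfolding z by auto
    also have "\<bar>z\<bar> \<le> (z\<^sup>2 + s * s) / (2 * s)"
    proof -
      have "0 \<le> (\<bar>z\<bar> - s)\<^sup>2" by simp
      also have "\<dots> = z\<^sup>2 + s * s - \<bar>z\<bar> * (2 * s)"
        by (simp add: power2_diff) (simp add: power2_eq_square)
      finally show ?thesis using s by (subst pos_le_divide_eq) auto
    qed
    also have "\<dots> = z\<^sup>2 / (2 * s) + s / 2" using s(1) by (simp add: add_divide_distrib)
    finally show ?thesis by (simp add: z_def)
  qed
  define W where "W = (\<Sum>x\<in>UNIV. pmf \<tau> x * (l x - m)\<^sup>2)"
  have W: "W \<le> V"
    unfolding W_def V_def l_def m_def using supp by (intro variance_log_ratio_le) auto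
  have W': "?S (\<lambda>xs. (sum_list (map (\<lambda>x. l x - m) xs))\<^sup>2) = real n * W"
    unfolding t_def W_def
    by (rule sum_prod_list_length_mult_sum_list_square)
       (simp_all add: sum_pmf_UNIV right_diff_distrib sum_subtractf m_def flip: sum_distrib_right)
  have "?S (\<lambda>xs. max 0 (real n * r - sum_list (map l xs))) \<le>
      ?S (\<lambda>xs. (sum_list (map (\<lambda>x. l x - m) xs))\<^sup>2 / (2 * s) + s / 2)"
    using dev t0 by (intro sum_mono mult_left_mono) auto
  also have "\<dots> = ?S (\<lambda>xs. (sum_list (map (\<lambda>x. l x - m) xs))\<^sup>2) / (2 * s) +
      (\<Sum>xs | length xs = n. t xs) * (s / 2)"
    by (simp add: sum_divide_distrib sum_distrib_right distrib_left sum.distrib)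
  also have "\<dots> = s * (W + 1) / 2"
    unfolding W' t1 s(2) using s(1) by (simp add: field_simps)
  also have "\<dots> \<le> s * (V + 1) / 2"
    using W s(1) by (intro divide_right_mono mult_left_mono) auto
  finally have var: "?S (\<lambda>xs. max 0 (real n * r - sum_list (map l xs))) \<le> sqrt (real n) * (V + 1) / 2"
    by (simp add: s_def)
  have "exp (- (real n * (\<Sum>x\<in>UNIV. pmf \<tau> x * d x)) - sqrt (real n) * (V + 1) / 2) \<le>
      exp (- ?S (\<lambda>xs. sum_list (map d xs)) - ?S (\<lambda>xs. max 0 (real n * r - sum_list (map l xs))))"
    using var by (simp add: t_def sum_prod_list_length_mult_sum_list sum_pmf_UNIV)
  also have "\<dots> = exp (?S (\<lambda>xs. - sum_list (map d xs) - max 0 (real n * r - sum_list (map l xs))))"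
    by (simp add: right_diff_distrib sum_subtractf sum_negf)
  also have "\<dots> \<le> ?S (\<lambda>xs. exp (- sum_list (map d xs) - max 0 (real n * r - sum_list (map l xs))))"
    by (intro sum_weighted_exp_ge t0 t1)
  also have "\<dots> \<le> test_value n \<rho> (universal_test r \<sigma> n)"
    unfolding test_value_eq t_def d_def l_def
    by (intro sum_mono universal_test_term_ge supp)
  finally show ?thesis by (simp add: d_def)
qed

section \<open>Tilted laws and the Hoeffding anti-divergence\<close>

lemma ex_pmf_eq:
  fixes f :: "'a::finite \<Rightarrow> real"
  assumes "\<And>x. f x \<ge> 0" "(\<Sum>x\<in>UNIV. f x) = 1"
  shows "\<exists>p. pmf p = f"
proof -
  have "(\<integral>\<^sup>+ x. ennreal (f x) \<partial>count_space UNIV) = 1"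
    using assms by (simp add: nn_integral_count_space_finite sum_ennreal)
  then have "pmf (embed_pmf f) = f"
    using assms by (intro ext pmf_embed_pmf) auto
  then show ?thesis by blast
qed

lemma ex_max_ratio: "\<exists>x. x \<in> max_ratio_set \<rho> \<sigma>"
proof -
  let ?f = "\<lambda>x. pmf \<rho> x / pmf \<sigma> x"
  have "Max (?f ` set_pmf \<sigma>) \<in> ?f ` set_pmf \<sigma>"
    by (intro Max_in) (auto simp: set_pmf_not_empty)
  then obtain x where "x \<in> set_pmf \<sigma>" "?f x = Max (?f ` set_pmf \<sigma>)" by auto
  then have "x \<in> max_ratio_set \<rho> \<sigma>" by (auto simp: max_ratio_set_def)
  then show ?thesis ..
qed

text \<open>
  The witness is proportional to \<open>\<rho>\<^sup>\<alpha> \<sigma>\<^sup>1\<^sup>-\<^sup>\<alpha>\<close>. Its divergence from \<open>\<sigma>\<close> is \<open>D(\<rho>\<parallel>\<sigma>)\<close> at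
  \<open>\<alpha> = 1\<close> and tends to \<open>r\<^sub>\<infinity>(\<rho>\<parallel>\<sigma>)\<close> as \<open>\<alpha> \<rightarrow> \<infinity>\<close>, so it equals \<open>r\<close> for some \<open>\<alpha>\<close>. Dividing the
  density ratio by its maximum \<open>M\<close> keeps the powers bounded in this limit.
\<close>

lemma ex_tilted_pmf:
  fixes \<rho> \<sigma> :: "'a::finite pmf"
  assumes supp: "set_pmf \<rho> \<subseteq> set_pmf \<sigma>"
    and less: "(\<Sum>x\<in>UNIV. pmf \<rho> x * ln (pmf \<rho> x / pmf \<sigma> x)) < r"
    and r_infty: "ereal r < r_infty \<rho> \<sigma>"
  shows "\<exists>\<tau> \<alpha>. \<alpha> > 1 \<and> set_pmf \<tau> \<subseteq> set_pmf \<rho> \<and>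
    (\<Sum>x\<in>UNIV. pmf \<tau> x * ln (pmf \<tau> x / pmf \<sigma> x)) = r \<and>
    ereal (\<Sum>x\<in>UNIV. pmf \<tau> x * ln (pmf \<tau> x / pmf \<rho> x)) =
      ereal ((\<alpha> - 1) / \<alpha>) * (ereal r - renyi_div \<alpha> \<rho> \<sigma>)"
proof -
  let ?S = "set_pmf \<rho>" and ?X = "max_ratio_set \<rho> \<sigma>"
  define p where "p = pmf \<rho>"
  define q where "q = pmf \<sigma>"
  have p: "p x > 0" "q x > 0" if "x \<in> ?S" for x
    using that supp by (auto simp: p_def q_def pmf_positive_iff)
  obtain x0 where x0: "x0 \<in> ?X" using ex_max_ratio by blast
  define M where "M = p x0 / q x0"
  have M_ge: "p x / q x \<le> M" if "x \<in> set_pmf \<sigma>" for x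
    using x0 that by (auto simp: M_def p_def q_def max_ratio_set_def)
  obtain y where y: "y \<in> ?S" using set_pmf_not_empty by fast
  have "0 < p y / q y" using p[OF y] by simp
  also have "\<dots> \<le> M" using y supp by (intro M_ge) auto
  finally have M: "M > 0" .
  \<comment> \<open>Because \<open>M > 0\<close>, maximisers of the ratio over the support of
    \<open>\<sigma>\<close> lie in the support of \<open>\<rho>\<close>.\<close>
  have X_iff: "x \<in> ?X \<longleftrightarrow> x \<in> ?S \<and> p x / q x = M" for x
  proof
    assume x: "x \<in> ?X"
    then have "p x / q x = M"
      using x0 by (auto simp: max_ratio_set_def M_def p_def q_def intro: antisym)
    with M show "x \<in> ?S \<and> p x / q x = M" by (auto simp: p_def set_pmf_iff)
  next
    assume "x \<in> ?S \<and> p x / q x = M"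
    with supp M_ge show "x \<in> ?X" by (auto simp: max_ratio_set_def p_def q_def)
  qed
  define a where "a = (\<lambda>x. p x / q x / M)"
  have a: "a x > 0" "a x \<le> 1" "x \<in> ?X \<longleftrightarrow> a x = 1" "p x = q x * a x * M" if "x \<in> ?S" for x
  proof -
    have le: "p x / q x \<le> M" using M_ge that supp by auto
    define z where "z = p x / q x"
    have "0 < z" "p x = q x * z" "a x = z / M" using p[OF that] by (simp_all add: z_def a_def)
    then show "a x > 0" "a x \<le> 1" "x \<in> ?X \<longleftrightarrow> a x = 1" "p x = q x * a x * M"
      using le M that unfolding X_iff z_def[symmetric] by auto
  qed
  have nz: "a x \<noteq> 0" "q x \<noteq> 0" if "x \<in> ?S" for x
    using a(1)[OF that] p(2)[OF that] by auto
  define N where "N = (\<lambda>\<alpha>. \<Sum>x\<in>?S. q x * a x powr \<alpha>)"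
  have N: "N \<alpha> > 0" for \<alpha>
    unfolding N_def using p(2) nz by (intro sum_pos mult_pos_pos) (simp_all add: set_pmf_not_empty)
  \<comment> \<open>On the support of \<open>\<rho>\<close>, \<open>p = q * a * M\<close>, so
    \<open>p powr \<alpha> * q powr (1 - \<alpha>)\<close> is
    \<open>M powr \<alpha> * (q * a powr \<alpha>)\<close>; the factor
    \<open>M powr \<alpha>\<close> cancels in the normalisation.\<close>
  define t where "t = (\<lambda>\<alpha> x. if x \<in> ?S then q x * a x powr \<alpha> / N \<alpha> else 0)"
  have t_sum: "(\<Sum>x\<in>UNIV. t \<alpha> x * h x) = (\<Sum>x\<in>?S. t \<alpha> x * h x)" for \<alpha> h
    by (rule sum.mono_neutral_right) (auto simp: t_def)
  have t1: "(\<Sum>x\<in>?S. t \<alpha> x) = 1" for \<alpha>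
    using N[of \<alpha>] by (simp add: t_def N_def flip: sum_divide_distrib)
  \<comment> \<open>\<open>E \<alpha>\<close> is the mean of \<open>ln a\<close> under the tilted
    law. Both divergences of that law, from \<open>q\<close> and from \<open>p\<close>, are affine
    in \<open>E \<alpha>\<close> and \<open>ln (N \<alpha>)\<close>.\<close>
  define E where "E = (\<lambda>\<alpha>. \<Sum>x\<in>?S. t \<alpha> x * ln (a x))"
  define F where "F = (\<lambda>\<alpha>. \<alpha> * E \<alpha> - ln (N \<alpha>))"
  have div_q: "(\<Sum>x\<in>UNIV. t \<alpha> x * ln (t \<alpha> x / q x)) = F \<alpha>" for \<alpha>
  proof -
    have "t \<alpha> x * ln (t \<alpha> x / q x) = \<alpha> * (t \<alpha> x * ln (a x)) - ln (N \<alpha>) * t \<alpha> x" if "x \<in> ?S" for x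
    proof -
      have "t \<alpha> x / q x = a x powr \<alpha> / N \<alpha>" using that p[OF that] by (simp add: t_def)
      then have ln_eq: "ln (t \<alpha> x / q x) = \<alpha> * ln (a x) - ln (N \<alpha>)"
        using a[OF that] N[of \<alpha>] by (simp add: ln_div ln_powr)
      show ?thesis unfolding ln_eq by (simp add: algebra_simps)
    qed
    then have "(\<Sum>x\<in>UNIV. t \<alpha> x * ln (t \<alpha> x / q x)) = 
        (\<Sum>x\<in>?S. \<alpha> * (t \<alpha> x * ln (a x)) - ln (N \<alpha>) * t \<alpha> x)"
      unfolding t_sum by (intro sum.cong) auto
    then show ?thesis
      by (simp add: F_def E_def sum_subtractf t1 flip: sum_distrib_left)
  qed
  have div_p: "(\<Sum>x\<in>UNIV. t \<alpha> x * ln (t \<alpha> x / p x)) = (\<alpha> - 1) * E \<alpha> - ln (N \<alpha>) - ln M" for \<alpha>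
  proof -
    have "t \<alpha> x * ln (t \<alpha> x / p x) = (\<alpha> - 1) * (t \<alpha> x * ln (a x)) - (ln (N \<alpha>) + ln M) * t \<alpha> x"
      if "x \<in> ?S" for x
    proof -
      have "t \<alpha> x / p x = a x powr \<alpha> / (a x * (N \<alpha> * M))" using that p[OF that] a[OF that] M by (simp add: t_def)
      then have ln_eq: "ln (t \<alpha> x / p x) = (\<alpha> - 1) * ln (a x) - ln (N \<alpha>) - ln M"
        using a(1)[OF that] N[of \<alpha>] M
        by (simp add: ln_div ln_mult_pos ln_powr left_diff_distrib)
      show ?thesis unfolding ln_eq by (simp add: algebra_simps)
    qed
    then have "(\<Sum>x\<in>UNIV. t \<alpha> x * ln (t \<alpha> x / p x)) = 
        (\<Sum>x\<in>?S. (\<alpha> - 1) * (t \<alpha> x * ln (a x)) - (ln (N \<alpha>) + ln M) * t \<alpha> x)"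
      unfolding t_sum by (intro sum.cong) auto
    then show ?thesis
      by (simp add: E_def sum_subtractf t1 flip: sum_distrib_left)
  qed
  have a_1: "\<bar>a x\<bar> = a x" if "x \<in> ?S" for x
    using a(1)[OF that] by simp
  have "t 1 = p"
  proof
    fix x
    have "N 1 * M = (\<Sum>x\<in>?S. p x)"
      unfolding N_def sum_distrib_right by (intro sum.cong) (simp_all add: a(4) a_1)
    also have "\<dots> = 1" unfolding p_def by (intro sum_pmf_eq_1) auto
    finally have "N 1 = 1 / M" using M by (simp add: field_simps)
    then show "t 1 x = p x"
    proof (cases "x \<in> ?S")
      case True
      then show ?thesis using a_1[OF True] a(4)[OF True] \<open>N 1 = 1 / M\<close> by (simp add: t_def)
    qed (simp add: t_def p_def set_pmf_iff)
  qed
  then have F1: "F 1 < r" using less div_q[of 1] by (simp add: p_def q_def)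
  \<comment> \<open>The logarithm vanishes where \<open>a x = 1\<close>, and exponential decay beats
    the factor \<open>\<alpha>\<close> elsewhere. Hence only \<open>- ln (N \<alpha>)\<close>
    survives in the limit of \<open>F\<close>.\<close>
  have "((\<lambda>\<alpha>. \<alpha> * (a x powr \<alpha> * ln (a x))) \<longlongrightarrow> 0) at_top" if "x \<in> ?S" for x
  proof (cases "a x = 1")
    case False
    define c where "c = - ln (a x)"
    have c: "c > 0" using a[OF that] False by (simp add: c_def)
    then have "((\<lambda>\<alpha>. \<alpha> * (exp (- c * \<alpha>) * (- c))) \<longlongrightarrow> 0) at_top" by real_asymp
    then show ?thesis using a[OF that] by (simp add: c_def powr_def mult.commute)
  qed auto
  moreover have lim_powr: "((\<lambda>\<alpha>. a x powr \<alpha>) \<longlongrightarrow> (if x \<in> ?X then 1 else 0)) at_top" if "x \<in> ?S" for x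
  proof (cases "a x = 1")
    case False
    define c where "c = - ln (a x)"
    have c: "c > 0" using a[OF that] False by (simp add: c_def)
    then have "((\<lambda>\<alpha>. exp (- c * \<alpha>)) \<longlongrightarrow> 0) at_top" by real_asymp
    then show ?thesis using a[OF that] False by (simp add: c_def powr_def mult.commute)
  qed (use a[OF that] in auto)
  have prob_X: "measure_pmf.prob \<sigma> ?X = (\<Sum>x\<in>?S. q x * (if x \<in> ?X then 1 else 0))"
  proof -
    have "measure_pmf.prob \<sigma> ?X = (\<Sum>x\<in>?X. q x)"
      by (simp add: measure_measure_pmf_finite q_def)
    also have "\<dots> = (\<Sum>x\<in>?S. q x * (if x \<in> ?X then 1 else 0))"
      by (rule sum.mono_neutral_cong_left) (auto simp: X_iff)
    finally show ?thesis .
  qed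
  \<comment> \<open>The powers tend to the indicator of the maximisers, so \<open>N\<close> tends to
    their \<open>\<sigma>\<close>-probability, whose negative logarithm is
    \<open>r_infty\<close>.\<close>
  have limN: "(N \<longlongrightarrow> measure_pmf.prob \<sigma> ?X) at_top"
    unfolding N_def prob_X using lim_powr by (intro tendsto_sum tendsto_mult tendsto_const) auto
  have "q x0 > 0" using x0 p by (auto simp: X_iff)
  then have X_pos: "measure_pmf.prob \<sigma> ?X > 0"
    using x0 by (auto simp: q_def pmf_positive_iff intro!: measure_pmf_posI)
  ultimately have "((\<lambda>\<alpha>. (\<Sum>x\<in>?S. q x * (\<alpha> * (a x powr \<alpha> * ln (a x))) / N \<alpha>) - ln (N \<alpha>)) \<longlongrightarrow>
      (\<Sum>x\<in>?S. q x * 0 / measure_pmf.prob \<sigma> ?X) - ln (measure_pmf.prob \<sigma> ?X)) at_top"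
    using limN by (intro tendsto_intros tendsto_sum) auto
  moreover have "(\<Sum>x\<in>?S. q x * (\<alpha> * (a x powr \<alpha> * ln (a x))) / N \<alpha>) - ln (N \<alpha>) = F \<alpha>" for \<alpha>
    unfolding F_def E_def sum_distrib_left by (auto intro!: sum.cong simp: t_def)
  ultimately have limF: "(F \<longlongrightarrow> - ln (measure_pmf.prob \<sigma> ?X)) at_top" by simp
  have "r < - ln (measure_pmf.prob \<sigma> ?X)"
    using r_infty supp X_pos by (simp add: r_infty_def neg_log_def)
  from order_tendstoD(1)[OF limF this] have "\<forall>\<^sub>F \<alpha> in at_top. r < F \<alpha> \<and> \<alpha> \<ge> 1"
    using eventually_ge_at_top[of 1] by eventually_elim auto
  then obtain A where A: "r < F A" "A \<ge> 1"
    by (auto dest!: eventually_happens)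
  have contN: "continuous_on {1..A} N"
    unfolding N_def using nz by (intro continuous_intros) auto
  have Nnz: "N \<alpha> \<noteq> 0" for \<alpha> using N[of \<alpha>] by simp
  have "F = (\<lambda>\<alpha>. \<alpha> * (\<Sum>x\<in>?S. q x * a x powr \<alpha> / N \<alpha> * ln (a x)) - ln (N \<alpha>))"
    by (simp add: F_def E_def t_def fun_eq_iff)
  moreover have "continuous_on {1..A} \<dots>"
    using nz Nnz by (intro continuous_intros contN) auto
  ultimately have "continuous_on {1..A} F" by simp
  then obtain \<alpha> where \<alpha>: "1 \<le> \<alpha>" "F \<alpha> = r"
    using IVT'[of F 1 r A] F1 A by auto
  then have "\<alpha> > 1" using F1 by (cases "\<alpha> = 1") auto
  have "\<exists>\<tau>. pmf \<tau> = t \<alpha>"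
    using t_sum[of \<alpha> "\<lambda>_. 1"] t1[of \<alpha>] p(2) N[of \<alpha>]
    by (intro ex_pmf_eq) (auto simp: t_def less_imp_le)
  then obtain \<tau> where \<tau>: "pmf \<tau> = t \<alpha>" ..
  have "(\<Sum>x\<in>?S. pmf \<rho> x powr \<alpha> * pmf \<sigma> x powr (1 - \<alpha>)) = M powr \<alpha> * N \<alpha>"
    unfolding N_def sum_distrib_left p_def[symmetric] q_def[symmetric]
    using a p M by (intro sum.cong) (auto simp: powr_mult powr_diff less_imp_le)
  then have "renyi_div \<alpha> \<rho> \<sigma> = ereal ((\<alpha> * ln M + ln (N \<alpha>)) / (\<alpha> - 1))"
    using supp M N[of \<alpha>] by (simp add: renyi_div_def ln_mult_pos ln_powr)
  \<comment> \<open>The equation \<open>F \<alpha> = r\<close> expresses \<open>E \<alpha>\<close>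
    through \<open>r\<close> and \<open>N \<alpha>\<close>. Inserted into \<open>div_p\<close>, it
    turns the divergence from \<open>\<rho>\<close> into the \<open>\<alpha>\<close>-term of the
    anti-divergence.\<close>
  moreover have "(\<alpha> - 1) * E \<alpha> - ln (N \<alpha>) - ln M =
      (\<alpha> - 1) / \<alpha> * (r - (\<alpha> * ln M + ln (N \<alpha>)) / (\<alpha> - 1))"
  proof -
    have "E \<alpha> = (r + ln (N \<alpha>)) / \<alpha>" using \<alpha> \<open>\<alpha> > 1\<close> by (auto simp: F_def field_simps)
    moreover have "(\<alpha> - 1) * ((r + L) / \<alpha>) - L - m = (\<alpha> - 1) / \<alpha> * (r - (\<alpha> * m + L) / (\<alpha> - 1))" for L m
      using \<open>\<alpha> > 1\<close> by (simp add: divide_simps) algebra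
    ultimately show ?thesis by simp
  qed
  moreover have "set_pmf \<tau> \<subseteq> ?S" by (auto simp: set_pmf_iff \<tau> t_def)
  ultimately show ?thesis
    using \<open>\<alpha> > 1\<close> div_q[of \<alpha>] div_p[of \<alpha>] \<alpha>(2) unfolding p_def q_def
    by (intro exI[of _ \<tau>] exI[of _ \<alpha>]) (simp add: \<tau>)
qed

text \<open>If \<open>D(\<rho>\<parallel>\<sigma>) < r\<close>, the tilted law works, its divergence
  from \<open>\<rho>\<close> being one of the terms under the supremum. Otherwise
  \<open>\<rho>\<close> itself works, with divergence 0 from itself.\<close>

lemma ex_pmf_div_le_hoeffding_anti_div:
  fixes \<rho> \<sigma> :: "'a::finite pmf"
  assumes supp: "set_pmf \<rho> \<subseteq> set_pmf \<sigma>" and "ereal r < r_infty \<rho> \<sigma>"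
  shows "\<exists>\<tau>. set_pmf \<tau> \<subseteq> set_pmf \<rho> \<and>
    r \<le> (\<Sum>x\<in>UNIV. pmf \<tau> x * ln (pmf \<tau> x / pmf \<sigma> x)) \<and>
    ereal (\<Sum>x\<in>UNIV. pmf \<tau> x * ln (pmf \<tau> x / pmf \<rho> x)) \<le> hoeffding_anti_div r \<rho> \<sigma>"
proof (cases "(\<Sum>x\<in>UNIV. pmf \<rho> x * ln (pmf \<rho> x / pmf \<sigma> x)) < r")
  case True
  from ex_tilted_pmf[OF supp this assms(2)] obtain \<tau> \<alpha> where \<tau>: "\<alpha> > 1" "set_pmf \<tau> \<subseteq> set_pmf \<rho>"
    "(\<Sum>x\<in>UNIV. pmf \<tau> x * ln (pmf \<tau> x / pmf \<sigma> x)) = r"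
    "ereal (\<Sum>x\<in>UNIV. pmf \<tau> x * ln (pmf \<tau> x / pmf \<rho> x)) =
       ereal ((\<alpha> - 1) / \<alpha>) * (ereal r - renyi_div \<alpha> \<rho> \<sigma>)"
    by blast
  have "ereal (\<Sum>x\<in>UNIV. pmf \<tau> x * ln (pmf \<tau> x / pmf \<rho> x)) \<le> hoeffding_anti_div r \<rho> \<sigma>"
    unfolding hoeffding_anti_div_def \<tau>(4) using \<tau>(1) by (intro max.coboundedI2 SUP_upper) auto
  with \<tau> show ?thesis by (intro exI[of _ \<tau>]) auto
next
  case False
  have "(\<Sum>x\<in>UNIV. pmf \<rho> x * ln (pmf \<rho> x / pmf \<rho> x)) = 0"
    by (rule sum.neutral) auto
  with False show ?thesis
    by (intro exI[of _ \<rho>]) (simp add: hoeffding_anti_div_def zero_ereal_def[symmetric])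
qed

section \<open>Uniformity over \<open>R\<close> and equality of the three quantities\<close>

lemma ex_pmf_lower_bound:
  fixes R :: "'a::finite pmf set"
  assumes "(SUP \<rho>\<in>R. neg_log (Min (pmf \<rho> ` set_pmf \<rho>))) < \<infinity>"
  shows "\<exists>\<delta>>0. \<forall>\<rho>\<in>R. \<forall>x\<in>set_pmf \<rho>. \<delta> \<le> pmf \<rho> x"
proof -
  obtain K where K: "(SUP \<rho>\<in>R. neg_log (Min (pmf \<rho> ` set_pmf \<rho>))) < ereal K"
    using assms less_PInf_Ex_of_nat[of "SUP \<rho>\<in>R. neg_log (Min (pmf \<rho> ` set_pmf \<rho>))"] by auto
  have "exp (- K) \<le> pmf \<rho> x" if \<rho>: "\<rho> \<in> R" and x: "x \<in> set_pmf \<rho>" for \<rho> x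
  proof -
    let ?m = "Min (pmf \<rho> ` set_pmf \<rho>)"
    have m: "?m \<in> pmf \<rho> ` set_pmf \<rho>" by (intro Min_in) (auto simp: set_pmf_not_empty)
    then have pos: "?m > 0" by (auto simp: pmf_positive_iff)
    have "neg_log ?m < ereal K" using K \<rho> by (meson SUP_upper order.strict_trans1)
    then have "- K < ln ?m" using pos by (simp add: neg_log_def split: if_splits)
    then have "exp (- K) < ?m" using pos by (metis exp_less_cancel_iff exp_ln)
    also have "?m \<le> pmf \<rho> x" using x by (intro Min_le) auto
    finally show ?thesis by simp
  qed
  then show ?thesis by (intro exI[of _ "exp (- K)"]) auto
qed

text \<open>The lower bound \<open>exp (- u n)\<close> on the acceptance probability is the same for
  every \<open>\<rho>\<close> in \<open>R\<close>, so it survives the infimum over \<open>R\<close>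
  inside the logarithm.\<close>

lemma sc_exponent_set_le_hoeffding_anti_div_set:
  fixes R :: "'a::finite pmf set" and \<sigma> :: "'a pmf" and r :: real
  assumes "R \<noteq> {}"
    and "(SUP \<rho>\<in>R. neg_log (Min (pmf \<rho> ` set_pmf \<rho>))) < \<infinity>"
    and r: "ereal r < (INF \<rho>\<in>R. r_infty \<rho> \<sigma>)"
  shows "sc_exponent_set r R \<sigma> \<le> hoeffding_anti_div_set r R \<sigma>"
proof (cases "hoeffding_anti_div_set r R \<sigma> = \<infinity>")
  case False
  have nonneg: "0 \<le> hoeffding_anti_div r \<rho> \<sigma>" for \<rho>
    by (simp add: hoeffding_anti_div_def)
  have le_H: "hoeffding_anti_div r \<rho> \<sigma> \<le> hoeffding_anti_div_set r R \<sigma>" if "\<rho> \<in> R" for \<rho>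
    using that by (auto simp: hoeffding_anti_div_set_def intro: SUP_upper)
  have "0 \<le> hoeffding_anti_div_set r R \<sigma>"
    using assms(1) nonneg le_H by (meson ex_in_conv order.trans)
  then obtain h where h: "hoeffding_anti_div_set r R \<sigma> = ereal h" "h \<ge> 0"
    using False by (cases "hoeffding_anti_div_set r R \<sigma>") auto
  obtain \<delta> where \<delta>: "\<delta> > 0" "\<And>\<rho> x. \<rho> \<in> R \<Longrightarrow> x \<in> set_pmf \<rho> \<Longrightarrow> \<delta> \<le> pmf \<rho> x"
    using ex_pmf_lower_bound[OF assms(2)] by auto
  define c where "c = ((\<Sum>x\<in>UNIV. 8 + 2 * (ln (pmf \<sigma> x))\<^sup>2) + 1) / 2"
  have c: "c \<ge> 0" unfolding c_def by (intro divide_nonneg_pos add_nonneg_nonneg sum_nonneg) auto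
  \<comment> \<open>The first two terms serve the \<open>\<rho>\<close> supported within
    \<open>\<sigma>\<close>, the last one those that are not. After division by \<open>n\<close>
    only \<open>h\<close> remains in the limit.\<close>
  define u where "u = (\<lambda>n. real n * h + sqrt (real n) * c + \<bar>ln \<delta>\<bar>)"
  have ge: "exp (- u n) \<le> test_value n \<rho> (universal_test r \<sigma> n)" if "\<rho> \<in> R" "n > 0" for n \<rho>
  proof (cases "set_pmf \<rho> \<subseteq> set_pmf \<sigma>")
    case True
    have "ereal r < r_infty \<rho> \<sigma>" using r that(1) by (meson INF_lower order_less_le_trans)
    from ex_pmf_div_le_hoeffding_anti_div[OF True this]
    obtain \<tau> where \<tau>: "set_pmf \<tau> \<subseteq> set_pmf \<rho>"
      "r \<le> (\<Sum>x\<in>UNIV. pmf \<tau> x * ln (pmf \<tau> x / pmf \<sigma> x))"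
      "ereal (\<Sum>x\<in>UNIV. pmf \<tau> x * ln (pmf \<tau> x / pmf \<rho> x)) \<le> hoeffding_anti_div r \<rho> \<sigma>"
      by blast
    let ?D = "\<Sum>x\<in>UNIV. pmf \<tau> x * ln (pmf \<tau> x / pmf \<rho> x)"
    have "?D \<le> h" using order.trans[OF \<tau>(3) le_H[OF that(1)]] by (simp add: h)
    then have "real n * ?D \<le> real n * h" by (intro mult_left_mono) auto
    then have "exp (- u n) \<le> exp (- (real n * ?D) - sqrt (real n) * ((\<Sum>x\<in>UNIV. 8 + 2 * (ln (pmf \<sigma> x))\<^sup>2) + 1) / 2)"
      by (simp add: u_def c_def)
    also have "\<dots> \<le> test_value n \<rho> (universal_test r \<sigma> n)"
      by (rule universal_test_value_ge[OF \<tau>(1) True \<tau>(2) that(2)])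
    finally show ?thesis .
  next
    case False
    have "0 \<le> real n * h + sqrt (real n) * c" using h c by simp
    then have "exp (- u n) \<le> exp (ln \<delta>)" unfolding u_def exp_le_cancel_iff by linarith
    also have "\<dots> = \<delta>" using \<delta> by simp
    also have "\<dots> \<le> test_value n \<rho> (universal_test r \<sigma> n)"
      using \<delta> that False by (intro universal_test_value_ge_outside) auto
    finally show ?thesis .
  qed
  have "sc_exponent_set r R \<sigma> \<le>
      limsup (\<lambda>n. ereal (1 / real n) * neg_log (INF \<rho>\<in>R. test_value n \<rho> (universal_test r \<sigma> n)))"
    unfolding sc_exponent_set_def using test_seq_universal_test liminf_universal_test_ge
    by (intro Inf_lower) blast
  also have "\<dots> \<le> limsup (\<lambda>n. ereal (u n / real n))"
  proof (rule Limsup_mono)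
    show "\<forall>\<^sub>F n in sequentially. ereal (1 / real n) * neg_log (INF \<rho>\<in>R. test_value n \<rho> (universal_test r \<sigma> n))
        \<le> ereal (u n / real n)"
      using eventually_gt_at_top[of 0]
    proof eventually_elim
      case (elim n)
      have "exp (- u n) \<le> (INF \<rho>\<in>R. test_value n \<rho> (universal_test r \<sigma> n))"
        using assms(1) ge elim by (intro cINF_greatest) auto
      then have "neg_log (INF \<rho>\<in>R. test_value n \<rho> (universal_test r \<sigma> n)) \<le> neg_log (exp (- u n))"
        by (intro neg_log_antimono) auto
      then have "ereal (1 / real n) * neg_log (INF \<rho>\<in>R. test_value n \<rho> (universal_test r \<sigma> n))
          \<le> ereal (1 / real n) * neg_log (exp (- u n))"
        by (intro ereal_mult_left_mono) auto
      then show ?case by (simp add: neg_log_def)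
    qed
  qed
  also have "limsup (\<lambda>n. ereal (u n / real n)) = ereal h"
  proof (rule lim_imp_Limsup)
    have "(\<lambda>n. u n / real n) \<longlonglongrightarrow> h" unfolding u_def by real_asymp
    then show "(\<lambda>n. ereal (u n / real n)) \<longlonglongrightarrow> ereal h" by simp
  qed simp
  finally show ?thesis by (simp add: h)
qed simp

theorem theoremV26:
  fixes R :: "'a::finite pmf set" and \<sigma> :: "'a pmf" and r :: real
  assumes "R \<noteq> {}"
    and "(SUP \<rho>\<in>R. neg_log (Min (pmf \<rho> ` set_pmf \<rho>))) < \<infinity>"
    and "rel_entropy_set R \<sigma> < ereal r"
    and "ereal r < (INF \<rho>\<in>R. r_infty \<rho> \<sigma>)"
  shows "sc_exponent_set r R \<sigma> = hoeffding_anti_div_set r R \<sigma> \<and>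
         hoeffding_anti_div_set r R \<sigma> = (SUP \<rho>\<in>R. sc_exponent r \<rho> \<sigma>)"
proof -
  have "sc_exponent_set r R \<sigma> \<le> hoeffding_anti_div_set r R \<sigma>"
    using assms by (intro sc_exponent_set_le_hoeffding_anti_div_set)
  moreover have "hoeffding_anti_div_set r R \<sigma> \<le> (SUP \<rho>\<in>R. sc_exponent r \<rho> \<sigma>)"
    unfolding hoeffding_anti_div_set_def by (intro SUP_mono) (auto intro: hoeffding_anti_div_le_sc_exponent)
  moreover have "(SUP \<rho>\<in>R. sc_exponent r \<rho> \<sigma>) \<le> sc_exponent_set r R \<sigma>"
    by (intro SUP_least sc_exponent_le_sc_exponent_set)
  ultimately show ?thesis by auto
qed

end
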